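(* Let $n\ge 1$ and let $\mathcal{B}=\{\emptyset\}\sqcup\{(x,y): x\le y,\ x,y\in\overline{[n]}\}$ be the Kang--Kashiwara--Misra level $1$ perfect crystal of type $C_n^{(1)}$, with the Kang--Kashiwara--Misra energy function $H$ described in the context. Then $H(\emptyset\otimes\emptyset)=0$, $H(\emptyset\otimes(x,y))=H((x,y)\otimes\emptyset)=1$ for all $x\le y$ in $\overline{[n]}$, and for all $x\le y$, $x'\le y'$ in $\overline{[n]}$, $$H((x,y)\otimes(x',y'))=\begin{cases}\chi(x\ge x')+\chi(y\ge y')-\chi(y\ge y'>x\ge x') & \text{if } \overline{y'}\ne x,\\ \chi(x>x')+\chi(y>y')-\chi(y>y'>x>x') & \text{if } \overline{y'}=x,\end{cases}$$ where $\chi(P)=1$ if the proposition $P$ holds and $0$ otherwise.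
   Context: $\overline{[n]}=\{1,\dots,n,\overline{n},\dots,\overline{1}\}$ with total order $1<2<\dots<n<\overline{n}<\overline{n-1}<\dots<\overline{1}$ and the convention $\overline{\overline{k}}=k$. The crystal is identified with vectors $b=(x_1,\dots,x_n,\overline{x}_n,\dots,\overline{x}_1)$ of non-negative integers (coordinates indexed by $\overline{[n]}$) whose sum $s(b)=\sum_{k=1}^n(x_k+\overline{x}_k)$ is $0$ or $2$: $\emptyset$ corresponds to the zero vector, and $(x,y)$ (with $x\le y$) corresponds to $e_x+e_y$, where $e_j$ is the vector with a $1$ in position $j$ and $0$ elsewhere. For $b=(x_1,\dots,\overline{x}_1)$ and $b'=(x'_1,\dots,\overline{x}'_1)$ the Kang--Kashiwara--Misra energy function is $H(b\otimes b')=\max\{\theta_j,\theta'_j,\eta_j,\eta'_j : 1\le j\le n\}$ (each evaluated at $b\otimes b'$), where $\theta_j=\sum_{k=1}^{j-1}(\overline{x}_k-\overline{x}'_k)+\frac{s(b')-s(b)}{2}$, $\theta'_j=\sum_{k=1}^{j-1}(x'_k-x_k)+\frac{s(b)-s(b')}{2}$, $\eta_j=\sum_{k=1}^{j-1}(\overline{x}_k-\overline{x}'_k)+(\overline{x}_j-x_j)+\frac{s(b')-s(b)}{2}$, $\eta'_j=\sum_{k=1}^{j-1}(x'_k-x_k)+(x'_j-\overline{x}'_j)+\frac{s(b)-s(b')}{2}$. *)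

theory Defs
  imports Complex_Main
begin

text \<open>\<^term>\<open>Unbarred k\<close> stands for \<open>k\<close> and \<^term>\<open>Barred k\<close> for \<open>k\<close> overlined. The order
  \<open>1 < ... < n < bar n < ... < bar 1\<close> does not depend on \<open>n\<close> and is therefore defined on the whole
  type; the alphabet for a given \<open>n\<close> is \<open>letters n\<close>.\<close>

datatype letter = Unbarred nat | Barred nat

instantiation letter :: linorder
begin

fun less_eq_letter :: "letter \<Rightarrow> letter \<Rightarrow> bool" where
  "less_eq_letter (Unbarred i) (Unbarred j) \<longleftrightarrow> i \<le> j"
| "less_eq_letter (Unbarred i) (Barred j) \<longleftrightarrow> True"
| "less_eq_letter (Barred i) (Unbarred j) \<longleftrightarrow> False"
| "less_eq_letter (Barred i) (Barred j) \<longleftrightarrow> j \<le> i"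

definition less_letter :: "letter \<Rightarrow> letter \<Rightarrow> bool" where
  "less_letter a b \<longleftrightarrow> a \<le> b \<and> \<not> b \<le> a"

instance
proof
  fix x y z :: letter
  show "x < y \<longleftrightarrow> x \<le> y \<and> \<not> y \<le> x" by (rule less_letter_def)
  show "x \<le> x" by (cases x) auto
  show "x \<le> y \<Longrightarrow> y \<le> z \<Longrightarrow> x \<le> z" by (cases x; cases y; cases z) auto
  show "x \<le> y \<Longrightarrow> y \<le> x \<Longrightarrow> x = y" by (cases x; cases y) auto
  show "x \<le> y \<or> y \<le> x" by (cases x; cases y) auto
qed

end

fun bar :: "letter \<Rightarrow> letter" where
  "bar (Unbarred k) = Barred k"
| "bar (Barred k) = Unbarred k"

definition letters :: "nat \<Rightarrow> letter set" where
  "letters n = Unbarred ` {1..n} \<union> Barred ` {1..n}"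

datatype crystal_elem = EmptyElem | PairElem letter letter

definition crystal :: "nat \<Rightarrow> crystal_elem set" where
  "crystal n = {EmptyElem} \<union> {PairElem x y | x y. x \<in> letters n \<and> y \<in> letters n \<and> x \<le> y}"

definition unit_vec :: "letter \<Rightarrow> letter \<Rightarrow> nat" where
  "unit_vec j = (\<lambda>i. if i = j then 1 else 0)"

text \<open>A coordinate vector \<open>b\<close> is a function on letters: \<open>b (Unbarred k)\<close> is \<open>x\<^sub>k\<close> and
  \<open>b (Barred k)\<close> is the overlined \<open>x\<^sub>k\<close>.\<close>

fun coords :: "crystal_elem \<Rightarrow> letter \<Rightarrow> nat" where
  "coords EmptyElem = (\<lambda>i. 0)"
| "coords (PairElem x y) = (\<lambda>i. unit_vec x i + unit_vec y i)"

definition coord_sum :: "nat \<Rightarrow> (letter \<Rightarrow> nat) \<Rightarrow> nat" where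
  "coord_sum n b = (\<Sum>k=1..n. b (Unbarred k) + b (Barred k))"

definition theta :: "nat \<Rightarrow> (letter \<Rightarrow> nat) \<Rightarrow> (letter \<Rightarrow> nat) \<Rightarrow> nat \<Rightarrow> rat" where
  "theta n b b' j =
     (\<Sum>k=1..<j. of_nat (b (Barred k)) - of_nat (b' (Barred k)))
     + (of_nat (coord_sum n b') - of_nat (coord_sum n b)) / 2"

definition theta' :: "nat \<Rightarrow> (letter \<Rightarrow> nat) \<Rightarrow> (letter \<Rightarrow> nat) \<Rightarrow> nat \<Rightarrow> rat" where
  "theta' n b b' j =
     (\<Sum>k=1..<j. of_nat (b' (Unbarred k)) - of_nat (b (Unbarred k)))
     + (of_nat (coord_sum n b) - of_nat (coord_sum n b')) / 2"

definition eta :: "nat \<Rightarrow> (letter \<Rightarrow> nat) \<Rightarrow> (letter \<Rightarrow> nat) \<Rightarrow> nat \<Rightarrow> rat" where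
  "eta n b b' j =
     (\<Sum>k=1..<j. of_nat (b (Barred k)) - of_nat (b' (Barred k)))
     + (of_nat (b (Barred j)) - of_nat (b (Unbarred j)))
     + (of_nat (coord_sum n b') - of_nat (coord_sum n b)) / 2"

definition eta' :: "nat \<Rightarrow> (letter \<Rightarrow> nat) \<Rightarrow> (letter \<Rightarrow> nat) \<Rightarrow> nat \<Rightarrow> rat" where
  "eta' n b b' j =
     (\<Sum>k=1..<j. of_nat (b' (Unbarred k)) - of_nat (b (Unbarred k)))
     + (of_nat (b' (Unbarred j)) - of_nat (b' (Barred j)))
     + (of_nat (coord_sum n b) - of_nat (coord_sum n b')) / 2"

definition energy_vec :: "nat \<Rightarrow> (letter \<Rightarrow> nat) \<Rightarrow> (letter \<Rightarrow> nat) \<Rightarrow> rat" where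
  "energy_vec n b b' =
     Max (\<Union>j\<in>{1..n}. {theta n b b' j, theta' n b b' j, eta n b b' j, eta' n b b' j})"

definition energy :: "nat \<Rightarrow> crystal_elem \<Rightarrow> crystal_elem \<Rightarrow> rat" where
  "energy n p q = energy_vec n (coords p) (coords q)"

end

theory Submission
  imports Defs
begin

text \<open>Partial sums of coordinates count letters above a threshold: for \<open>b = (x, y)\<close> and
  \<open>b' = (x', y')\<close>, each of \<open>\<theta>\<^sub>j, \<theta>'\<^sub>j, \<eta>\<^sub>j, \<eta>'\<^sub>j\<close> is the number of letters of \<open>b\<close> above
  \<open>bar j\<close> or \<open>j\<close> minus the number of letters of \<open>b'\<close> above it (strictly or weakly), up to a
  correction in \<open>\<eta>\<close> and \<open>\<eta>'\<close>. Such a difference equals \<open>2\<close> only if the threshold separates \<open>y'\<close>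
  from \<open>x\<close>, and is positive only if it separates \<open>x'\<close> from \<open>x\<close> or \<open>y'\<close> from \<open>y\<close>; the correction
  matters exactly when \<open>bar y' = x\<close> and rules out the weak inequalities there. Conversely the
  thresholds given by \<open>x\<close> and \<open>y'\<close> attain the maximum.\<close>

section \<open>Letters and partial sums of unit vectors\<close>

lemma Unbarred_in_letters [simp]: "Unbarred k \<in> letters n \<longleftrightarrow> 1 \<le> k \<and> k \<le> n"
  and Barred_in_letters [simp]: "Barred k \<in> letters n \<longleftrightarrow> 1 \<le> k \<and> k \<le> n"
  by (auto simp: letters_def)

lemma less_letter_simps [simp]:
  "Unbarred i < Unbarred j \<longleftrightarrow> i < j"
  "Unbarred i < Barred j"
  "\<not> Barred i < Unbarred j"
  "Barred i < Barred j \<longleftrightarrow> j < i"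
  by (auto simp: less_letter_def)

lemma coord_sum_unit_vec: "x \<in> letters n \<Longrightarrow> coord_sum n (unit_vec x) = 1"
  by (cases x) (auto simp: coord_sum_def unit_vec_def sum.distrib)

lemma coord_sum_coords_PairElem:
  assumes "x \<in> letters n" "y \<in> letters n"
  shows "coord_sum n (coords (PairElem x y)) = 2"
proof -
  have "coord_sum n (coords (PairElem x y)) = coord_sum n (unit_vec x) + coord_sum n (unit_vec y)"
    by (simp add: coord_sum_def sum.distrib)
  then show ?thesis
    using assms by (simp add: coord_sum_unit_vec)
qed

text \<open>Barred letters are ordered in reverse, so \<open>k < j\<close> picks exactly the letters
  above \<open>Barred j\<close>.\<close>

lemma sum_unit_vec_Barred:
  assumes "x \<in> letters n"
  shows "(\<Sum>k=1..<j. of_nat (unit_vec x (Barred k))) = (of_bool (x > Barred j) :: rat)"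
  using assms by (cases x) (auto simp: unit_vec_def if_distrib[of of_nat] cong: if_cong)

lemma sum_unit_vec_Unbarred:
  assumes "x \<in> letters n"
  shows "(\<Sum>k=1..<j. of_nat (unit_vec x (Unbarred k))) = (of_bool (x < Unbarred j) :: rat)"
  using assms by (cases x) (auto simp: unit_vec_def if_distrib[of of_nat] cong: if_cong)

lemma of_nat_unit_vec: "of_nat (unit_vec x i) = of_bool (i = x)"
  by (simp add: unit_vec_def)

lemma of_bool_le_letter: "of_bool (x \<le> y) = of_bool (x < y) + (of_bool (x = y) :: rat)"
  for x y :: letter
  by auto

lemma of_bool_less_letter: "of_bool (x < y) = 1 - (of_bool (y \<le> x) :: rat)"
  for x y :: letter
  by auto

lemma eta_eq_theta:
  "eta n b b' j = theta n b b' j + (of_nat (b (Barred j)) - of_nat (b (Unbarred j)))"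
  by (simp add: eta_def theta_def)

lemma eta'_eq_theta':
  "eta' n b b' j = theta' n b b' j + (of_nat (b' (Unbarred j)) - of_nat (b' (Barred j)))"
  by (simp add: eta'_def theta'_def)

section \<open>The four functions as threshold counts\<close>

context
  fixes n :: nat and x y x' y' :: letter
  assumes letters: "x \<in> letters n" "y \<in> letters n" "x' \<in> letters n" "y' \<in> letters n"
begin

lemma theta_PairElem:
  "theta n (coords (PairElem x y)) (coords (PairElem x' y')) j =
     of_bool (x > Barred j) + of_bool (y > Barred j)
     - of_bool (x' > Barred j) - of_bool (y' > Barred j)"
  unfolding theta_def coord_sum_coords_PairElem[OF letters(1,2)]
    coord_sum_coords_PairElem[OF letters(3,4)]
  by (simp only: coords.simps of_nat_add sum.distrib sum_subtractf
    sum_unit_vec_Barred[OF letters(1)] sum_unit_vec_Barred[OF letters(2)]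
    sum_unit_vec_Barred[OF letters(3)] sum_unit_vec_Barred[OF letters(4)])
    (simp split del: split_of_bool)

text \<open>The sums count letters below \<open>Unbarred j\<close>. Each pair has two letters in
  all, so passing to complements gives counts from \<open>Unbarred j\<close> upwards and swaps the
  roles of the two pairs.\<close>

lemma theta'_PairElem:
  "theta' n (coords (PairElem x y)) (coords (PairElem x' y')) j =
     of_bool (x \<ge> Unbarred j) + of_bool (y \<ge> Unbarred j)
     - of_bool (x' \<ge> Unbarred j) - of_bool (y' \<ge> Unbarred j)"
  unfolding theta'_def coord_sum_coords_PairElem[OF letters(1,2)]
    coord_sum_coords_PairElem[OF letters(3,4)]
  by (simp only: coords.simps of_nat_add sum.distrib sum_subtractf
    sum_unit_vec_Unbarred[OF letters(1)] sum_unit_vec_Unbarred[OF letters(2)]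
    sum_unit_vec_Unbarred[OF letters(3)] sum_unit_vec_Unbarred[OF letters(4)])
    (simp add: of_bool_less_letter split del: split_of_bool)

text \<open>The added barred coordinate of \<open>b\<close> makes the strict counts for
  \<open>x\<close> and \<open>y\<close> weak; its unbarred coordinate stays as the
  correction.\<close>

lemma eta_PairElem:
  "eta n (coords (PairElem x y)) (coords (PairElem x' y')) j =
     of_bool (x \<ge> Barred j) + of_bool (y \<ge> Barred j)
     - of_bool (x' > Barred j) - of_bool (y' > Barred j)
     - (of_bool (Unbarred j = x) + of_bool (Unbarred j = y))"
  unfolding eta_eq_theta theta_PairElem of_bool_le_letter
  by (simp add: of_nat_unit_vec split del: split_of_bool)

text \<open>Here the added unbarred coordinate of \<open>b'\<close> makes the subtracted weak counts
  for \<open>x'\<close> and \<open>y'\<close> strict.\<close>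

lemma eta'_PairElem:
  "eta' n (coords (PairElem x y)) (coords (PairElem x' y')) j =
     of_bool (x \<ge> Unbarred j) + of_bool (y \<ge> Unbarred j)
     - of_bool (x' > Unbarred j) - of_bool (y' > Unbarred j)
     - (of_bool (Barred j = x') + of_bool (Barred j = y'))"
  unfolding eta'_eq_theta' theta'_PairElem of_bool_le_letter
  by (simp add: of_nat_unit_vec split del: split_of_bool)

end

section \<open>The closed formula sorted by its value\<close>

text \<open>Listing the cases by value 2, 1, 0 lets the upper bound and its attainment be checked
  level by level.\<close>

definition pair_energy :: "letter \<Rightarrow> letter \<Rightarrow> letter \<Rightarrow> letter \<Rightarrow> rat" where
  "pair_energy x y x' y' =
    (if y' \<le> x then 2
     else if x' < x \<or> y' < y \<or> bar y' \<noteq> x \<and> (x' = x \<or> y' = y) then 1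
     else 0)"

lemma bar_neq [simp]: "bar l \<noteq> l" "l \<noteq> bar l"
  by (cases l; simp)+

lemma bar_eq_iff [simp]:
  "bar l = Barred j \<longleftrightarrow> l = Unbarred j"
  "bar l = Unbarred j \<longleftrightarrow> l = Barred j"
  by (cases l; auto)+

text \<open>If \<open>y' \<le> x\<close>, then both indicators are 1 and the subtracted term is 0.
  If \<open>x < y'\<close>, the subtracted term is the product of the two indicators, and
  inclusion-exclusion leaves the indicator of their disjunction.\<close>

lemma pair_energy_eq:
  assumes "x \<le> y" "x' \<le> y'"
  shows "pair_energy x y x' y' =
    (if bar y' \<noteq> x
     then of_bool (x \<ge> x') + of_bool (y \<ge> y') - of_bool (y \<ge> y' \<and> y' > x \<and> x \<ge> x')
     else of_bool (x > x') + of_bool (y > y') - of_bool (y > y' \<and> y' > x \<and> x > x'))"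
proof (cases "y' \<le> x")
  case True
  \<comment> \<open>No letter is its own bar, so in the strict branch \<open>y' \<le> x\<close> is
    already strict and both strict indicators are 1.\<close>
  then have "bar y' = x \<Longrightarrow> y' < x"
    by (auto simp: order_less_le)
  then show ?thesis
    using True assms by (auto simp: pair_energy_def)
next
  case False
  then show ?thesis
    using assms by (auto simp: pair_energy_def)
qed

section \<open>Upper bounds for threshold counts\<close>

text \<open>With \<open>A\<close>, \<open>B\<close>, \<open>C\<close>, \<open>D\<close> telling
  whether \<open>x\<close>, \<open>y\<close>, \<open>x'\<close>, \<open>y'\<close> pass a threshold,
  the hypotheses treat the possible values of the difference one by one.\<close>

lemma of_bool_diff_le:
  assumes "0 \<le> e" and "A \<and> \<not> C \<or> B \<and> \<not> D \<Longrightarrow> 1 \<le> e"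
    and "A \<Longrightarrow> \<not> D \<Longrightarrow> \<not> C \<Longrightarrow> 2 \<le> e"
  shows "of_bool A + of_bool B - of_bool C - of_bool D \<le> (e :: rat)"
  using assms by (cases A; cases B; cases C; cases D; simp)

context
  fixes x y x' y' :: letter
  assumes le: "x \<le> y" "x' \<le> y'"
begin

lemma pair_energy_bounds:
  "0 \<le> pair_energy x y x' y'"
  "y' \<le> x \<Longrightarrow> 2 \<le> pair_energy x y x' y'"
  "x' < x \<or> y' < y \<Longrightarrow> 1 \<le> pair_energy x y x' y'"
  "x' \<le> x \<or> y' \<le> y \<Longrightarrow> bar y' \<noteq> x \<Longrightarrow> 1 \<le> pair_energy x y x' y'"
  by (auto simp: pair_energy_def)

text \<open>Both counts are strict, so a threshold between two letters separates them strictly: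
  \<open>x > l\<close> and \<open>l \<ge> x'\<close> give \<open>x' < x\<close>. The case
  \<open>bar y' = x\<close> thus needs no correction.\<close>

lemma count_greater_le_pair_energy:
  "of_bool (x > l) + of_bool (y > l) - of_bool (x' > l) - of_bool (y' > l)
    \<le> pair_energy x y x' y'"
  by (rule of_bool_diff_le) (intro pair_energy_bounds; auto simp: not_less)+

lemma count_ge_le_pair_energy:
  "of_bool (x \<ge> l) + of_bool (y \<ge> l) - of_bool (x' \<ge> l) - of_bool (y' \<ge> l)
    \<le> pair_energy x y x' y'"
  by (rule of_bool_diff_le) (intro pair_energy_bounds; auto simp: not_le)+

text \<open>A weak count minus a strict one also detects equality of letters at the threshold. When
  \<open>bar y' = x\<close>, equality alone does not raise \<open>pair_energy\<close> to 1, and the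
  correction \<open>d\<close> has to absorb the excess.\<close>

lemma count_ge_greater_le_pair_energy:
  assumes "0 \<le> d"
    and "bar y' = x \<Longrightarrow> x' = x \<and> x = l \<or> y' = y \<and> y = l \<Longrightarrow> 1 \<le> d"
  shows "of_bool (x \<ge> l) + of_bool (y \<ge> l) - of_bool (x' > l) - of_bool (y' > l) - d
    \<le> pair_energy x y x' y'"
proof -
  have "of_bool (x \<ge> l) + of_bool (y \<ge> l) - of_bool (x' > l) - of_bool (y' > l)
      \<le> pair_energy x y x' y' + d"
  proof (rule of_bool_diff_le)
    show "0 \<le> pair_energy x y x' y' + d"
      using pair_energy_bounds(1) assms(1) by simp
    show "2 \<le> pair_energy x y x' y' + d" if "l \<le> x" "\<not> l < y'"
      using pair_energy_bounds(2) assms(1) that by fastforce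
    assume *: "l \<le> x \<and> \<not> l < x' \<or> l \<le> y \<and> \<not> l < y'"
    show "1 \<le> pair_energy x y x' y' + d"
    proof (cases "bar y' = x \<and> (x' = x \<and> x = l \<or> y' = y \<and> y = l)")
      case True
      then show ?thesis
        using assms(2) pair_energy_bounds(1) by fastforce
    next
      case False
      have "1 \<le> pair_energy x y x' y'"
      proof (cases "bar y' = x")
        case True
        then show ?thesis using False * by (intro pair_energy_bounds(3)) auto
      next
        case bar: False
        then show ?thesis using * by (intro pair_energy_bounds(4)) auto
      qed
      then show ?thesis
        using assms(1) by simp
    qed
  qed
  then show ?thesis
    by simp
qed

end

section \<open>Attainment of the maximum for two pairs\<close>

text \<open>A lower bound at a single index suffices, since the upper bound turns it into
  equality.\<close>

lemma energy_eqI: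
  assumes "\<And>j. j \<in> {1..n} \<Longrightarrow>
      theta n (coords p) (coords q) j \<le> e \<and> theta' n (coords p) (coords q) j \<le> e
      \<and> eta n (coords p) (coords q) j \<le> e \<and> eta' n (coords p) (coords q) j \<le> e"
    and "j \<in> {1..n}"
    and "e \<le> theta n (coords p) (coords q) j \<or> e \<le> theta' n (coords p) (coords q) j
      \<or> e \<le> eta n (coords p) (coords q) j \<or> e \<le> eta' n (coords p) (coords q) j"
  shows "energy n p q = e"
  unfolding energy_def energy_vec_def
proof (rule Max_eqI)
  show "e \<in> (\<Union>j\<in>{1..n}. {theta n (coords p) (coords q) j, theta' n (coords p) (coords q) j,
      eta n (coords p) (coords q) j, eta' n (coords p) (coords q) j})"
    using assms(1)[OF assms(2)] assms(2,3) by (intro UN_I[of j]) auto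
qed (use assms(1) in auto)

lemma letter_index:
  assumes "l \<in> letters n"
  obtains j where "j \<in> {1..n}" "l = Unbarred j \<or> l = Barred j"
  using assms by (auto simp: letters_def)

lemma one_le_of_bool_diff:
  assumes "B" "\<not> C" "A \<or> \<not> D"
  shows "1 \<le> of_bool A + of_bool B - of_bool C - (of_bool D :: rat)"
  using assms by auto

lemma energy_PairElem_PairElem:
  assumes letters: "x \<in> letters n" "y \<in> letters n" "x' \<in> letters n" "y' \<in> letters n"
    and le: "x \<le> y" "x' \<le> y'"
  shows "energy n (PairElem x y) (PairElem x' y') = pair_energy x y x' y'"
proof -
  note formulas = theta_PairElem[OF letters] theta'_PairElem[OF letters]
    eta_PairElem[OF letters] eta'_PairElem[OF letters]
  define witness where "witness v j \<longleftrightarrow> j \<in> {1..n} \<and>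
      (v \<le> theta n (coords (PairElem x y)) (coords (PairElem x' y')) j \<or>
       v \<le> theta' n (coords (PairElem x y)) (coords (PairElem x' y')) j \<or>
       v \<le> eta n (coords (PairElem x y)) (coords (PairElem x' y')) j \<or>
       v \<le> eta' n (coords (PairElem x y)) (coords (PairElem x' y')) j)" for v j
  obtain i where i: "i \<in> {1..n}" "x = Unbarred i \<or> x = Barred i"
    using letter_index[OF letters(1)] .
  obtain k where k: "k \<in> {1..n}" "y' = Unbarred k \<or> y' = Barred k"
    using letter_index[OF letters(4)] .
  \<comment> \<open>The threshold is \<open>x\<close> itself, through \<open>eta'\<close> or
    \<open>eta\<close>: it counts \<open>x\<close> and \<open>y\<close> but neither
    \<open>x'\<close> nor \<open>y'\<close>. The correction vanishes because it concerns letters on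
    the other side of the threshold.\<close>
  have two: "witness 2 i" if "y' \<le> x"
    using i(2)
  proof
    assume x: "x = Unbarred i"
    have "Unbarred i \<le> x" "Unbarred i \<le> y" "\<not> Unbarred i < x'" "\<not> Unbarred i < y'"
      using that le x by auto
    moreover from this have "Barred i \<noteq> x'" "Barred i \<noteq> y'"
      by auto
    ultimately show ?thesis
      using i(1) by (simp only: witness_def formulas) simp
  next
    assume x: "x = Barred i"
    have "Barred i \<le> x" "Barred i \<le> y" "\<not> Barred i < x'" "\<not> Barred i < y'"
      using that le x by auto
    moreover from this have "Unbarred i \<noteq> x" "Unbarred i \<noteq> y"
      by auto
    ultimately show ?thesis
      using i(1) by (simp only: witness_def formulas) simp
  qed
  \<comment> \<open>At threshold \<open>x\<close>, both \<open>x\<close> and \<open>y\<close> count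
    and \<open>x'\<close> does not. For unbarred \<open>x\<close>, \<open>theta'\<close> is taken
    instead of \<open>eta'\<close>, whose correction would be nonzero if
    \<open>y' = bar x\<close>.\<close>
  have "witness 1 i" if "x' < x" "x < y'"
    using i(2)
  proof
    assume x: "x = Unbarred i"
    have "Unbarred i \<le> x" "Unbarred i \<le> y" "\<not> Unbarred i \<le> x'"
      using that le x by auto
    then have "1 \<le> theta' n (coords (PairElem x y)) (coords (PairElem x' y')) i"
      unfolding formulas by (intro one_le_of_bool_diff) auto
    then show ?thesis
      using i(1) unfolding witness_def by blast
  next
    assume x: "x = Barred i"
    have "Barred i \<le> x" "Barred i \<le> y" "\<not> Barred i < x'"
      using that le x by auto
    moreover from this have "Unbarred i \<noteq> x" "Unbarred i \<noteq> y"
      by auto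
    ultimately have "1 \<le> eta n (coords (PairElem x y)) (coords (PairElem x' y')) i"
      unfolding formulas by (simp add: one_le_of_bool_diff split del: split_of_bool)
    then show ?thesis
      using i(1) unfolding witness_def by blast
  qed
  \<comment> \<open>Dually, the threshold is \<open>y'\<close>; for barred \<open>y'\<close>,
    \<open>theta\<close> avoids the correction in \<open>eta\<close> when
    \<open>x = bar y'\<close>.\<close>
  moreover have "witness 1 k" if "y' < y" "x < y'"
    using k(2)
  proof
    assume y': "y' = Unbarred k"
    have "Unbarred k \<le> y" "\<not> Unbarred k < x'" "\<not> Unbarred k < y'"
      using that le y' by auto
    moreover from this have "Barred k \<noteq> x'" "Barred k \<noteq> y'"
      by auto
    ultimately have "1 \<le> eta' n (coords (PairElem x y)) (coords (PairElem x' y')) k"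
      unfolding formulas by (simp add: one_le_of_bool_diff split del: split_of_bool)
    then show ?thesis
      using k(1) unfolding witness_def by blast
  next
    assume y': "y' = Barred k"
    have "Barred k < y" "\<not> Barred k < x'" "\<not> Barred k < y'"
      using that le y' by auto
    then have "1 \<le> theta n (coords (PairElem x y)) (coords (PairElem x' y')) k"
      unfolding formulas by (intro one_le_of_bool_diff) auto
    then show ?thesis
      using k(1) unfolding witness_def by blast
  qed
  \<comment> \<open>Equality is only seen by a weak count minus a strict one, so \<open>eta'\<close>
    and \<open>eta\<close> are required; \<open>bar y' \<noteq> x\<close> removes the correction in
    \<open>eta'\<close>.\<close>
  moreover have "witness 1 i" if "x' = x" "bar y' \<noteq> x"
    using i(2)
  proof
    assume x: "x = Unbarred i"
    have "Unbarred i \<le> x" "Unbarred i \<le> y" "\<not> Unbarred i < x'" "Barred i \<noteq> x'" "Barred i \<noteq> y'"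
      using that le x by auto
    then have "1 \<le> eta' n (coords (PairElem x y)) (coords (PairElem x' y')) i"
      unfolding formulas by (simp add: one_le_of_bool_diff split del: split_of_bool)
    then show ?thesis
      using i(1) unfolding witness_def by blast
  next
    assume x: "x = Barred i"
    have "Barred i \<le> x" "Barred i \<le> y" "\<not> Barred i < x'"
      using that le x by auto
    moreover from this have "Unbarred i \<noteq> x" "Unbarred i \<noteq> y"
      by auto
    ultimately have "1 \<le> eta n (coords (PairElem x y)) (coords (PairElem x' y')) i"
      unfolding formulas by (simp add: one_le_of_bool_diff split del: split_of_bool)
    then show ?thesis
      using i(1) unfolding witness_def by blast
  qed
  moreover have "witness 1 k" if "y' = y" "bar y' \<noteq> x"
    using k(2)
  proof
    assume y': "y' = Unbarred k"
    have "Unbarred k \<le> y" "\<not> Unbarred k < x'" "\<not> Unbarred k < y'"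
      using that le y' by auto
    moreover from this have "Barred k \<noteq> x'" "Barred k \<noteq> y'"
      by auto
    ultimately have "1 \<le> eta' n (coords (PairElem x y)) (coords (PairElem x' y')) k"
      unfolding formulas by (simp add: one_le_of_bool_diff split del: split_of_bool)
    then show ?thesis
      using k(1) unfolding witness_def by blast
  next
    assume y': "y' = Barred k"
    have "Barred k \<le> y" "\<not> Barred k < x'" "\<not> Barred k < y'" "Unbarred k \<noteq> x" "Unbarred k \<noteq> y"
      using that le y' by auto
    then have "1 \<le> eta n (coords (PairElem x y)) (coords (PairElem x' y')) k"
      unfolding formulas by (simp add: one_le_of_bool_diff split del: split_of_bool)
    then show ?thesis
      using k(1) unfolding witness_def by blast
  qed
  ultimately have one: "witness 1 i \<or> witness 1 k"
    if "x < y'" "x' < x \<or> y' < y \<or> bar y' \<noteq> x \<and> (x' = x \<or> y' = y)"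
    using that by blast
  \<comment> \<open>At index 1 the partial sum is empty and the coordinate sums agree, so
    \<open>theta\<close> is 0.\<close>
  have zero: "witness 0 1"
  proof -
    have "1 \<in> {1..n}" using i(1) by auto
    moreover have "theta n b b' 1 = (of_nat (coord_sum n b') - of_nat (coord_sum n b)) / 2" for b b'
      by (simp add: theta_def)
    ultimately show ?thesis
      using letters by (simp only: witness_def coord_sum_coords_PairElem) simp
  qed
  obtain j where "witness (pair_energy x y x' y') j"
  proof (cases "y' \<le> x")
    case True
    with two that[of i] show ?thesis
      by (simp add: pair_energy_def)
  next
    case False
    show ?thesis
    proof (cases "x' < x \<or> y' < y \<or> bar y' \<noteq> x \<and> (x' = x \<or> y' = y)")
      case True
      then have "pair_energy x y x' y' = 1"
        using False unfolding pair_energy_def by (simp only: if_True if_False)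
      then show ?thesis
        using one[OF _ True] False that by (auto simp: not_le)
    next
      case no: False
      then have "pair_energy x y x' y' = 0"
        using False unfolding pair_energy_def by (simp only: if_False)
      then show ?thesis
        using zero that by simp
    qed
  qed
  then show ?thesis
    unfolding witness_def
  proof (elim conjE, intro energy_eqI)
    fix j
    show "theta n (coords (PairElem x y)) (coords (PairElem x' y')) j \<le> pair_energy x y x' y' \<and>
          theta' n (coords (PairElem x y)) (coords (PairElem x' y')) j \<le> pair_energy x y x' y' \<and>
          eta n (coords (PairElem x y)) (coords (PairElem x' y')) j \<le> pair_energy x y x' y' \<and>
          eta' n (coords (PairElem x y)) (coords (PairElem x' y')) j \<le> pair_energy x y x' y'"
      \<comment> \<open>If \<open>bar y' = x\<close>, then for \<open>eta\<close> with
        \<open>l = Barred j\<close> the case \<open>x' = x = l\<close> contradicts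
        \<open>x' \<le> y'\<close>, and \<open>y' = y = l\<close> gives
        \<open>x = Unbarred j\<close>, hence correction at least 1. For \<open>eta'\<close> the two
        cases exchange roles.\<close>
      unfolding formulas using le
      by (intro conjI count_greater_le_pair_energy count_ge_le_pair_energy
          count_ge_greater_le_pair_energy) auto
  qed
qed

section \<open>Tensor products with the empty element\<close>

lemma energy_EmptyElem_EmptyElem:
  assumes "n \<ge> 1"
  shows "energy n EmptyElem EmptyElem = 0"
  using assms by (intro energy_eqI[where j = 1]) (auto simp: theta_def theta'_def eta_def eta'_def)

lemma coord_sum_coords_EmptyElem: "coord_sum n (coords EmptyElem) = 0"
  by (simp add: coord_sum_def)

text \<open>The half difference of coordinate sums is 1, attained by \<open>theta\<close> at index 1
  where the partial sum is empty. The other values are 1 minus a count or a count of at most two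
  letters minus 1, up to a subtracted coordinate.\<close>

lemma energy_EmptyElem_PairElem:
  assumes "n \<ge> 1" and letters: "x \<in> letters n" "y \<in> letters n"
  shows "energy n EmptyElem (PairElem x y) = 1"
proof -
  have theta: "theta n (coords EmptyElem) (coords (PairElem x y)) j =
      1 - of_bool (x > Barred j) - of_bool (y > Barred j)" for j
    unfolding theta_def coord_sum_coords_PairElem[OF letters] coord_sum_coords_EmptyElem
    by (simp add: sum.distrib sum_subtractf sum_unit_vec_Barred[OF letters(1)] sum_negf
        sum_unit_vec_Barred[OF letters(2)] del: One_nat_def split del: split_of_bool)
  have theta': "theta' n (coords EmptyElem) (coords (PairElem x y)) j =
      of_bool (x < Unbarred j) + of_bool (y < Unbarred j) - 1" for j
    unfolding theta'_def coord_sum_coords_PairElem[OF letters] coord_sum_coords_EmptyElem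
    by (simp add: sum.distrib sum_subtractf sum_unit_vec_Unbarred[OF letters(1)]
        sum_unit_vec_Unbarred[OF letters(2)] del: One_nat_def split del: split_of_bool)
  show ?thesis
  proof (rule energy_eqI[where j = 1])
    fix j
    show "theta n (coords EmptyElem) (coords (PairElem x y)) j \<le> 1 \<and>
        theta' n (coords EmptyElem) (coords (PairElem x y)) j \<le> 1 \<and>
        eta n (coords EmptyElem) (coords (PairElem x y)) j \<le> 1 \<and>
        eta' n (coords EmptyElem) (coords (PairElem x y)) j \<le> 1"
      unfolding eta_eq_theta eta'_eq_theta' theta theta' by (auto simp: unit_vec_def)
  qed (use assms in \<open>auto simp: theta_def coord_sum_coords_PairElem coord_sum_coords_EmptyElem
      simp del: coords.simps\<close>)
qed

text \<open>The mirror case: \<open>theta'\<close> at index 1 attains the value 1.\<close>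

lemma energy_PairElem_EmptyElem:
  assumes "n \<ge> 1" and letters: "x \<in> letters n" "y \<in> letters n"
  shows "energy n (PairElem x y) EmptyElem = 1"
proof -
  have theta: "theta n (coords (PairElem x y)) (coords EmptyElem) j =
      of_bool (x > Barred j) + of_bool (y > Barred j) - 1" for j
    unfolding theta_def coord_sum_coords_PairElem[OF letters] coord_sum_coords_EmptyElem
    by (simp add: sum.distrib sum_subtractf sum_unit_vec_Barred[OF letters(1)]
        sum_unit_vec_Barred[OF letters(2)] del: One_nat_def split del: split_of_bool)
  have theta': "theta' n (coords (PairElem x y)) (coords EmptyElem) j =
      1 - of_bool (x < Unbarred j) - of_bool (y < Unbarred j)" for j
    unfolding theta'_def coord_sum_coords_PairElem[OF letters] coord_sum_coords_EmptyElem
    by (simp add: sum.distrib sum_subtractf sum_unit_vec_Unbarred[OF letters(1)] sum_negf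
        sum_unit_vec_Unbarred[OF letters(2)] del: One_nat_def split del: split_of_bool)
  show ?thesis
  proof (rule energy_eqI[where j = 1])
    fix j
    show "theta n (coords (PairElem x y)) (coords EmptyElem) j \<le> 1 \<and>
        theta' n (coords (PairElem x y)) (coords EmptyElem) j \<le> 1 \<and>
        eta n (coords (PairElem x y)) (coords EmptyElem) j \<le> 1 \<and>
        eta' n (coords (PairElem x y)) (coords EmptyElem) j \<le> 1"
      unfolding eta_eq_theta eta'_eq_theta' theta theta' by (auto simp: unit_vec_def)
  qed (use assms in \<open>auto simp: theta'_def coord_sum_coords_PairElem coord_sum_coords_EmptyElem
      simp del: coords.simps\<close>)
qed

theorem theorem1p7:
  fixes n :: nat
  assumes "n \<ge> 1"
  shows "energy n EmptyElem EmptyElem = 0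
    \<and> (\<forall>x y. PairElem x y \<in> crystal n \<longrightarrow>
          energy n EmptyElem (PairElem x y) = 1 \<and> energy n (PairElem x y) EmptyElem = 1)
    \<and> (\<forall>x y x' y'. PairElem x y \<in> crystal n \<longrightarrow> PairElem x' y' \<in> crystal n \<longrightarrow>
          energy n (PairElem x y) (PairElem x' y') =
            (if bar y' \<noteq> x
             then of_bool (x \<ge> x') + of_bool (y \<ge> y')
                    - of_bool (y \<ge> y' \<and> y' > x \<and> x \<ge> x')
             else of_bool (x > x') + of_bool (y > y')
                    - of_bool (y > y' \<and> y' > x \<and> x > x')))"
proof (intro conjI allI impI)
  have mem: "x \<in> letters n \<and> y \<in> letters n \<and> x \<le> y" if "PairElem x y \<in> crystal n" for x y
    using that by (auto simp: crystal_def)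
  show "energy n EmptyElem EmptyElem = 0"
    using assms by (rule energy_EmptyElem_EmptyElem)
  show "energy n EmptyElem (PairElem x y) = 1" "energy n (PairElem x y) EmptyElem = 1"
    if "PairElem x y \<in> crystal n" for x y
    using assms mem[OF that] by (simp_all add: energy_EmptyElem_PairElem energy_PairElem_EmptyElem)
  fix x y x' y'
  assume "PairElem x y \<in> crystal n" "PairElem x' y' \<in> crystal n"
  then have "x \<in> letters n" "y \<in> letters n" "x' \<in> letters n" "y' \<in> letters n" "x \<le> y" "x' \<le> y'"
    using mem by blast+
  then show "energy n (PairElem x y) (PairElem x' y') =
            (if bar y' \<noteq> x
             then of_bool (x \<ge> x') + of_bool (y \<ge> y')
                    - of_bool (y \<ge> y' \<and> y' > x \<and> x \<ge> x')
             else of_bool (x > x') + of_bool (y > y')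
                    - of_bool (y > y' \<and> y' > x \<and> x > x'))"
    by (simp only: energy_PairElem_PairElem pair_energy_eq)
qed

end
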